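(* $\mathrm{WPO}(\mathcal A_{\mathrm{ms}})$ subsumes both LPO and KBO: (i) for every quasi-precedence $\succsim$ and status $\sigma$ there is an algebra $\mathcal A$ of the form $\mathcal A_{\mathrm{ms}}$ such that $\succ_{\mathrm{LPO}}=\succ_{\mathrm{WPO}(\mathcal A)}$ (both with $\succsim,\sigma$); (ii) for every quasi-precedence $\succsim$, status $\sigma$ and weight function $(w,w_0)$ with $w_0>0$ and $w$ admissible for $\succsim$, there is an algebra $\mathcal A$ of the form $\mathcal A_{\mathrm{ms}}$ such that $\succ_{\mathrm{KBO}}=\succ_{\mathrm{WPO}(\mathcal A)}$ (both with $\succsim,\sigma$, KBO with $(w,w_0)$).
   Context: Terms over a finite signature $\Sigma$ and variables $\mathcal V$; $|s|_x$ = number of occurrences of $x$ in $s$. Quasi-precedence: quasi-order $\succsim$ on $\Sigma$ with well-founded strict part $\succ$ and equivalence $\sim$. Status $\sigma$: $f\in\Sigma_n\mapsto$ permutation $[i_1..i_n]$, $\sigma(f)(s_1..s_n)=[s_{i_1},..,s_{i_n}]$. Lex extension of strict $\succ$ (reflexive closure $\succeq$): $[s_1..s_n]\succ^{\mathrm{lex}}[t_1..t_m]$ iff there is $k<n$ with $s_i\succeq t_i$ ($i\le k$) and either $k=m$, or $k<m$ and $s_{k+1}\succ t_{k+1}$. A weight function $(w,w_0)$: $w:\Sigma\to\mathbb N$, $w_0\in\mathbb N$, $w(c)\ge w_0$ for constants; $w(x)=w_0$, $w(f(s_1..s_n))=w(f)+\sum w(s_i)$. $w$ admissible for $\succsim$: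 every unary $f$ with $w(f)=0$ has $f\succsim g$ for all $g$. LPO: $s=f(s_1..s_n)\succ_{\mathrm{LPO}}t$ iff $s_i\succeq_{\mathrm{LPO}}t$ for some $i$, or $t=g(t_1..t_m)$, $s\succ_{\mathrm{LPO}}t_j$ for all $j$, and $f\succ g$ or ($f\sim g$ and $\sigma(f)(\vec s)\succ_{\mathrm{LPO}}^{\mathrm{lex}}\sigma(g)(\vec t)$). KBO: $s=f(s_1..s_n)\succ_{\mathrm{KBO}}t$ iff $|s|_x\ge|t|_x$ for all $x$ and either $w(s)>w(t)$, or $w(s)=w(t)$ and either ($t\in\mathcal V$ and $s=f^k(t)$, $k>0$) or ($t=g(t_1..t_m)$ and $f\succ g$ or ($f\sim g$ and $\sigma(f)(\vec s)\succ_{\mathrm{KBO}}^{\mathrm{lex}}\sigma(g)(\vec t)$)). In both, variables are greater than nothing. $\mathcal A_{\mathrm{ms}}$: given a weight function $(w,w_0)$, a penalty function $p(f,i)\in\mathbb N$, and a weight status mapping each $f$ to $\mathrm{Pol}$ or $\mathrm{Max}$; carrier $\{a\in\mathbb N\mid a\ge w_0\}$ with usual $\ge,>$; $f(a_1..a_n)=w(f)+\sum_i a_i$ if $f$ has status $\mathrm{Pol}$, and $\max(w(f),\max_i(p(f,i)+a_i))$ if $\mathrm{Max}$. $s\ge_{\mathcal A}t$ (resp. $>_{\mathcal A}$) iff $\hat\alpha(s)\ge\hat\alpha(t)$ (resp. $>$) for all assignments. WPO: no variable greater than any term; $s=f(s_1..s_n)\succ_{\mathrm{WPO}(\mathcal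 A)}t$ iff (1) $s>_{\mathcal A}t$, or (2) $s\ge_{\mathcal A}t$ and either $s_i\succeq_{\mathrm{WPO}(\mathcal A)}t$ for some $i$, or $t=g(t_1..t_m)$, $s\succ_{\mathrm{WPO}(\mathcal A)}t_j$ for all $j$, and $f\succ g$ or ($f\sim g$ and $\sigma(f)(\vec s)\succ^{\mathrm{lex}}_{\mathrm{WPO}(\mathcal A)}\sigma(g)(\vec t)$).
   Formalization: In KBO's variable case, s = f^k(t) is read modulo ~ (a tower f(h_2(...h_k(t))) with all h_i ~ f); with k copies of the same f, part (ii) fails when two distinct equivalent unary symbols have weight 0: f(g(x)) is WPO-greater but not KBO-greater than x. *)

theory Defs
  imports Main
begin

datatype ('f, 'v) trm = Var 'v | Fun 'f "('f, 'v) trm list"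

inductive_set terms :: "'f set \<Rightarrow> ('f \<Rightarrow> nat) \<Rightarrow> ('f, 'v) trm set"
  for F :: "'f set" and ar :: "'f \<Rightarrow> nat" where
  var: "Var x \<in> terms F ar"
| app: "f \<in> F \<Longrightarrow> length ss = ar f \<Longrightarrow> (\<forall>s \<in> set ss. s \<in> terms F ar)
    \<Longrightarrow> Fun f ss \<in> terms F ar"

fun occ :: "'v \<Rightarrow> ('f, 'v) trm \<Rightarrow> nat" where
  "occ x (Var y) = (if x = y then 1 else 0)"
| "occ x (Fun f ss) = (\<Sum>s\<leftarrow>ss. occ x s)"

definition prec_gt :: "('f \<Rightarrow> 'f \<Rightarrow> bool) \<Rightarrow> 'f \<Rightarrow> 'f \<Rightarrow> bool" where
  "prec_gt pr f g \<longleftrightarrow> pr f g \<and> \<not> pr g f"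

definition prec_eq :: "('f \<Rightarrow> 'f \<Rightarrow> bool) \<Rightarrow> 'f \<Rightarrow> 'f \<Rightarrow> bool" where
  "prec_eq pr f g \<longleftrightarrow> pr f g \<and> pr g f"

definition quasi_precedence :: "'f set \<Rightarrow> ('f \<Rightarrow> 'f \<Rightarrow> bool) \<Rightarrow> bool" where
  "quasi_precedence F pr \<longleftrightarrow>
     reflp_on F pr \<and> transp_on F pr \<and> wfp_on F (\<lambda>g f. prec_gt pr f g)"

text \<open>Argument positions are counted from 0 throughout.\<close>

definition is_status :: "'f set \<Rightarrow> ('f \<Rightarrow> nat) \<Rightarrow> ('f \<Rightarrow> nat list) \<Rightarrow> bool" where
  "is_status F ar \<sigma> \<longleftrightarrow> (\<forall>f \<in> F. distinct (\<sigma> f) \<and> set (\<sigma> f) = {..<ar f})"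

definition permute :: "nat list \<Rightarrow> 'a list \<Rightarrow> 'a list" where
  "permute is xs = map (\<lambda>i. xs ! i) is"

definition lex_ext :: "('a \<Rightarrow> 'a \<Rightarrow> bool) \<Rightarrow> 'a list \<Rightarrow> 'a list \<Rightarrow> bool" where
  "lex_ext gt ss ts \<longleftrightarrow>
     (\<exists>k < length ss. k \<le> length ts \<and>
        (\<forall>i < k. ss ! i = ts ! i \<or> gt (ss ! i) (ts ! i)) \<and>
        (k = length ts \<or> (k < length ts \<and> gt (ss ! k) (ts ! k))))"

lemma lex_ext_mono [mono]:
  assumes "\<And>x y. r x y \<longrightarrow> r' x y"
  shows "lex_ext r ss ts \<longrightarrow> lex_ext r' ss ts"
  using assms unfolding lex_ext_def by blast

inductive lpo :: "('f \<Rightarrow> 'f \<Rightarrow> bool) \<Rightarrow> ('f \<Rightarrow> nat list) \<Rightarrow> ('f, 'v) trm \<Rightarrow> ('f, 'v) trm \<Rightarrow> bool"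
  for pr :: "'f \<Rightarrow> 'f \<Rightarrow> bool" and \<sigma> :: "'f \<Rightarrow> nat list" where
  sub: "s \<in> set ss \<Longrightarrow> s = t \<or> lpo pr \<sigma> s t \<Longrightarrow> lpo pr \<sigma> (Fun f ss) t"
| prec: "(\<forall>t \<in> set ts. lpo pr \<sigma> (Fun f ss) t) \<Longrightarrow> prec_gt pr f g
    \<Longrightarrow> lpo pr \<sigma> (Fun f ss) (Fun g ts)"
| lex: "(\<forall>t \<in> set ts. lpo pr \<sigma> (Fun f ss) t) \<Longrightarrow> prec_eq pr f g
    \<Longrightarrow> lex_ext (lpo pr \<sigma>) (permute (\<sigma> f) ss) (permute (\<sigma> g) ts)
    \<Longrightarrow> lpo pr \<sigma> (Fun f ss) (Fun g ts)"

definition weight_function :: "'f set \<Rightarrow> ('f \<Rightarrow> nat) \<Rightarrow> ('f \<Rightarrow> nat) \<Rightarrow> nat \<Rightarrow> bool" where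
  "weight_function F ar w w0 \<longleftrightarrow> (\<forall>c \<in> F. ar c = 0 \<longrightarrow> w0 \<le> w c)"

definition admissible ::
  "'f set \<Rightarrow> ('f \<Rightarrow> nat) \<Rightarrow> ('f \<Rightarrow> 'f \<Rightarrow> bool) \<Rightarrow> ('f \<Rightarrow> nat) \<Rightarrow> bool" where
  "admissible F ar pr w \<longleftrightarrow> (\<forall>f \<in> F. ar f = 1 \<and> w f = 0 \<longrightarrow> (\<forall>g \<in> F. pr f g))"

fun weight :: "('f \<Rightarrow> nat) \<Rightarrow> nat \<Rightarrow> ('f, 'v) trm \<Rightarrow> nat" where
  "weight w w0 (Var x) = w0"
| "weight w w0 (Fun f ss) = w f + (\<Sum>s\<leftarrow>ss. weight w w0 s)"

text \<open>
  In the variable case of KBO, the tower \<open>f\<^sup>k(x)\<close> is read modulo the equivalence \<open>\<sim>\<close> of the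
  quasi-precedence: it is \<open>h\<^sub>1(\<dots>h\<^sub>k(x)\<dots>)\<close> with \<open>k > 0\<close>, \<open>h\<^sub>1 = f\<close> and all \<open>h\<^sub>i \<sim> f\<close>.
  Admissibility allows several unary symbols of weight 0, as long as they are equivalent. If
  \<open>f \<noteq> g\<close> are two of them, then with \<open>k\<close> copies of one and the same symbol KBO would satisfy
  \<open>f(g(x)) \<succ> g(x) \<succ> x\<close> but not \<open>f(g(x)) \<succ> x\<close>, whereas \<open>f(g(x)) \<succ> x\<close> holds in WPO over every
  algebra of the max/sum form below. If there is at most one such symbol, the two
  readings define the same order. See \<open>kbo_eq_kbo_syn\<close> and \<open>kbo_syn_neq_wpo\<close>.
\<close>

definition tower :: "'f list \<Rightarrow> ('f, 'v) trm \<Rightarrow> ('f, 'v) trm" where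
  "tower hs t = foldr (\<lambda>h u. Fun h [u]) hs t"

inductive kbo ::
  "('f \<Rightarrow> 'f \<Rightarrow> bool) \<Rightarrow> ('f \<Rightarrow> nat list) \<Rightarrow> ('f \<Rightarrow> nat) \<Rightarrow> nat
    \<Rightarrow> ('f, 'v) trm \<Rightarrow> ('f, 'v) trm \<Rightarrow> bool"
  for pr :: "'f \<Rightarrow> 'f \<Rightarrow> bool" and \<sigma> :: "'f \<Rightarrow> nat list" and w :: "'f \<Rightarrow> nat" and w0 :: nat where
  weight: "(\<forall>x. occ x t \<le> occ x (Fun f ss)) \<Longrightarrow> weight w w0 t < weight w w0 (Fun f ss)
    \<Longrightarrow> kbo pr \<sigma> w w0 (Fun f ss) t"
| var: "t = Var x \<Longrightarrow> (\<forall>y. occ y t \<le> occ y (Fun f ss))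
    \<Longrightarrow> weight w w0 (Fun f ss) = weight w w0 t
    \<Longrightarrow> Fun f ss = tower (f # hs) t \<Longrightarrow> (\<forall>h \<in> set hs. prec_eq pr h f)
    \<Longrightarrow> kbo pr \<sigma> w w0 (Fun f ss) t"
| prec: "(\<forall>x. occ x (Fun g ts) \<le> occ x (Fun f ss))
    \<Longrightarrow> weight w w0 (Fun f ss) = weight w w0 (Fun g ts) \<Longrightarrow> prec_gt pr f g
    \<Longrightarrow> kbo pr \<sigma> w w0 (Fun f ss) (Fun g ts)"
| lex: "(\<forall>x. occ x (Fun g ts) \<le> occ x (Fun f ss))
    \<Longrightarrow> weight w w0 (Fun f ss) = weight w w0 (Fun g ts) \<Longrightarrow> prec_eq pr f g
    \<Longrightarrow> lex_ext (kbo pr \<sigma> w w0) (permute (\<sigma> f) ss) (permute (\<sigma> g) ts)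
    \<Longrightarrow> kbo pr \<sigma> w w0 (Fun f ss) (Fun g ts)"

text \<open>KBO with towers of one and the same symbol.\<close>

inductive kbo_syn ::
  "('f \<Rightarrow> 'f \<Rightarrow> bool) \<Rightarrow> ('f \<Rightarrow> nat list) \<Rightarrow> ('f \<Rightarrow> nat) \<Rightarrow> nat
    \<Rightarrow> ('f, 'v) trm \<Rightarrow> ('f, 'v) trm \<Rightarrow> bool"
  for pr :: "'f \<Rightarrow> 'f \<Rightarrow> bool" and \<sigma> :: "'f \<Rightarrow> nat list" and w :: "'f \<Rightarrow> nat" and w0 :: nat where
  weight: "(\<forall>x. occ x t \<le> occ x (Fun f ss)) \<Longrightarrow> weight w w0 t < weight w w0 (Fun f ss)
    \<Longrightarrow> kbo_syn pr \<sigma> w w0 (Fun f ss) t"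
| var: "t = Var x \<Longrightarrow> (\<forall>y. occ y t \<le> occ y (Fun f ss))
    \<Longrightarrow> weight w w0 (Fun f ss) = weight w w0 t
    \<Longrightarrow> k > 0 \<Longrightarrow> Fun f ss = tower (replicate k f) t
    \<Longrightarrow> kbo_syn pr \<sigma> w w0 (Fun f ss) t"
| prec: "(\<forall>x. occ x (Fun g ts) \<le> occ x (Fun f ss))
    \<Longrightarrow> weight w w0 (Fun f ss) = weight w w0 (Fun g ts) \<Longrightarrow> prec_gt pr f g
    \<Longrightarrow> kbo_syn pr \<sigma> w w0 (Fun f ss) (Fun g ts)"
| lex: "(\<forall>x. occ x (Fun g ts) \<le> occ x (Fun f ss))
    \<Longrightarrow> weight w w0 (Fun f ss) = weight w w0 (Fun g ts) \<Longrightarrow> prec_eq pr f g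
    \<Longrightarrow> lex_ext (kbo_syn pr \<sigma> w w0) (permute (\<sigma> f) ss) (permute (\<sigma> g) ts)
    \<Longrightarrow> kbo_syn pr \<sigma> w w0 (Fun f ss) (Fun g ts)"

lemma weight_tower: "weight w w0 (tower hs t) = sum_list (map w hs) + weight w w0 t"
  by (induction hs) (auto simp: tower_def)

lemma tower_terms:
  "tower hs t \<in> terms F ar \<Longrightarrow> h \<in> set hs \<Longrightarrow> h \<in> F \<and> ar h = 1"
proof (induction hs)
  case (Cons a hs)
  have "Fun a [tower hs t] \<in> terms F ar"
    using Cons.prems by (simp add: tower_def)
  then have "a \<in> F" "ar a = 1" "tower hs t \<in> terms F ar"
    by (auto elim: terms.cases)
  with Cons show ?case by auto
qed simp

lemma permute_terms:
  assumes "is_status F ar \<sigma>" "Fun f ss \<in> terms F ar" "i < length (permute (\<sigma> f) ss)"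
  shows "permute (\<sigma> f) ss ! i \<in> terms F ar"
proof -
  have f: "f \<in> F" "length ss = ar f" "\<forall>s \<in> set ss. s \<in> terms F ar"
    using assms(2) by (auto elim: terms.cases)
  have "\<sigma> f ! i < ar f"
    using assms(1,3) f(1) nth_mem[of i "\<sigma> f"] by (auto simp: is_status_def permute_def)
  with f assms(3) show ?thesis by (simp add: permute_def)
qed

lemma lex_ext_impl:
  assumes "lex_ext r ss ts"
    and "\<And>i. i < length ss \<Longrightarrow> r (ss ! i) (ts ! i) \<Longrightarrow> r' (ss ! i) (ts ! i)"
  shows "lex_ext r' ss ts"
proof -
  obtain k where k: "k < length ss" "k \<le> length ts"
      "\<forall>i < k. ss ! i = ts ! i \<or> r (ss ! i) (ts ! i)"
      "k = length ts \<or> (k < length ts \<and> r (ss ! k) (ts ! k))"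
    using assms(1) unfolding lex_ext_def by blast
  then have "\<forall>i < k. ss ! i = ts ! i \<or> r' (ss ! i) (ts ! i)"
      "k = length ts \<or> (k < length ts \<and> r' (ss ! k) (ts ! k))"
    using assms(2) by (meson order.strict_trans)+
  with k(1,2) show ?thesis unfolding lex_ext_def by blast
qed

lemma kbo_eq_kbo_syn:
  fixes s t :: "('f, 'v) trm"
  assumes pr: "quasi_precedence F pr" and st: "is_status F ar \<sigma>"
    and uniq: "\<forall>f \<in> F. \<forall>g \<in> F. ar f = 1 \<and> w f = 0 \<and> ar g = 1 \<and> w g = 0 \<longrightarrow> f = g"
    and s: "s \<in> terms F ar"
  shows "kbo pr \<sigma> w w0 s t \<longleftrightarrow> kbo_syn pr \<sigma> w w0 s t"
proof
  assume "kbo pr \<sigma> w w0 s t"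
  then show "kbo_syn pr \<sigma> w w0 s t" using s
  proof (induction rule: kbo.induct)
    case (var t x f ss hs)
    have in_F: "\<And>h. h \<in> set (f # hs) \<Longrightarrow> h \<in> F \<and> ar h = 1"
      using tower_terms[of "f # hs" t] var by metis
    have "sum_list (map w (f # hs)) = 0"
      using var weight_tower[of w w0 "f # hs" t] by simp
    then have "\<And>h. h \<in> set (f # hs) \<Longrightarrow> w h = 0" by auto
    with in_F uniq have "\<And>h. h \<in> set (f # hs) \<Longrightarrow> h = f" by (metis list.set_intros(1))
    then have "f # hs = replicate (Suc (length hs)) f"
      by (metis length_Cons replicate_length_same)
    with var show ?case by (metis kbo_syn.var zero_less_Suc)
  next
    case (lex g ts f ss)
    have "lex_ext (kbo_syn pr \<sigma> w w0) (permute (\<sigma> f) ss) (permute (\<sigma> g) ts)"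
      by (rule lex_ext_impl[OF lex(4)]) (use permute_terms[OF st lex.prems] in blast)
    with lex show ?case by (blast intro: kbo_syn.lex)
  qed (blast intro: kbo_syn.intros)+
next
  assume "kbo_syn pr \<sigma> w w0 s t"
  then show "kbo pr \<sigma> w w0 s t" using s
  proof (induction rule: kbo_syn.induct)
    case (var t x f ss k)
    then obtain j where j: "replicate k f = f # replicate j f"
      by (cases k) auto
    have "f \<in> F" using var by (auto elim: terms.cases)
    with pr have "prec_eq pr f f"
      by (auto simp: quasi_precedence_def prec_eq_def dest: reflp_onD)
    with var j show ?case
      by (intro kbo.var[where hs = "replicate j f"]) auto
  next
    case (lex g ts f ss)
    have "lex_ext (kbo pr \<sigma> w w0) (permute (\<sigma> f) ss) (permute (\<sigma> g) ts)"
      by (rule lex_ext_impl[OF lex(4)]) (use permute_terms[OF st lex.prems] in blast)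
    with lex show ?case by (blast intro: kbo.lex)
  qed (blast intro: kbo.intros)+
qed

record ('f, 'a) ordered_algebra =
  carrier :: "'a set"
  interp :: "'f \<Rightarrow> 'a list \<Rightarrow> 'a"
  geq :: "'a \<Rightarrow> 'a \<Rightarrow> bool"
  gt :: "'a \<Rightarrow> 'a \<Rightarrow> bool"

fun eval :: "('f, 'a) ordered_algebra \<Rightarrow> ('v \<Rightarrow> 'a) \<Rightarrow> ('f, 'v) trm \<Rightarrow> 'a" where
  "eval A \<alpha> (Var x) = \<alpha> x"
| "eval A \<alpha> (Fun f ss) = interp A f (map (eval A \<alpha>) ss)"

definition alg_geq :: "('f, 'a) ordered_algebra \<Rightarrow> ('f, 'v) trm \<Rightarrow> ('f, 'v) trm \<Rightarrow> bool" where
  "alg_geq A s t \<longleftrightarrow> (\<forall>\<alpha>. (\<forall>x. \<alpha> x \<in> carrier A) \<longrightarrow> geq A (eval A \<alpha> s) (eval A \<alpha> t))"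

definition alg_gt :: "('f, 'a) ordered_algebra \<Rightarrow> ('f, 'v) trm \<Rightarrow> ('f, 'v) trm \<Rightarrow> bool" where
  "alg_gt A s t \<longleftrightarrow> (\<forall>\<alpha>. (\<forall>x. \<alpha> x \<in> carrier A) \<longrightarrow> gt A (eval A \<alpha> s) (eval A \<alpha> t))"

datatype weight_status = Pol | Max

definition ms_algebra ::
  "('f \<Rightarrow> nat) \<Rightarrow> nat \<Rightarrow> ('f \<Rightarrow> nat \<Rightarrow> nat) \<Rightarrow> ('f \<Rightarrow> weight_status) \<Rightarrow> ('f, nat) ordered_algebra" where
  "ms_algebra w w0 p ws =
    \<lparr> carrier = {a. w0 \<le> a},
      interp = (\<lambda>f as. case ws f of
          Pol \<Rightarrow> w f + sum_list as
        | Max \<Rightarrow> Lattices_Big.Max (insert (w f) {p f i + as ! i | i. i < length as})),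
      geq = (\<ge>),
      gt = (>) \<rparr>"

definition is_ms_algebra :: "'f set \<Rightarrow> ('f \<Rightarrow> nat) \<Rightarrow> ('f, nat) ordered_algebra \<Rightarrow> bool" where
  "is_ms_algebra F ar A \<longleftrightarrow>
     (\<exists>w w0 p ws. weight_function F ar w w0 \<and> A = ms_algebra w w0 p ws)"

inductive wpo ::
  "('f, 'a) ordered_algebra \<Rightarrow> ('f \<Rightarrow> 'f \<Rightarrow> bool) \<Rightarrow> ('f \<Rightarrow> nat list)
    \<Rightarrow> ('f, 'v) trm \<Rightarrow> ('f, 'v) trm \<Rightarrow> bool"
  for A :: "('f, 'a) ordered_algebra" and pr :: "'f \<Rightarrow> 'f \<Rightarrow> bool" and \<sigma> :: "'f \<Rightarrow> nat list" where
  gt: "alg_gt A (Fun f ss) t \<Longrightarrow> wpo A pr \<sigma> (Fun f ss) t"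
| sub: "alg_geq A (Fun f ss) t \<Longrightarrow> s \<in> set ss \<Longrightarrow> s = t \<or> wpo A pr \<sigma> s t
    \<Longrightarrow> wpo A pr \<sigma> (Fun f ss) t"
| prec: "alg_geq A (Fun f ss) (Fun g ts) \<Longrightarrow> (\<forall>t \<in> set ts. wpo A pr \<sigma> (Fun f ss) t)
    \<Longrightarrow> prec_gt pr f g \<Longrightarrow> wpo A pr \<sigma> (Fun f ss) (Fun g ts)"
| lex: "alg_geq A (Fun f ss) (Fun g ts) \<Longrightarrow> (\<forall>t \<in> set ts. wpo A pr \<sigma> (Fun f ss) t)
    \<Longrightarrow> prec_eq pr f g
    \<Longrightarrow> lex_ext (wpo A pr \<sigma>) (permute (\<sigma> f) ss) (permute (\<sigma> g) ts)
    \<Longrightarrow> wpo A pr \<sigma> (Fun f ss) (Fun g ts)"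

lemma ms_algebra_unary:
  assumes "is_ms_algebra F ar A"
  shows "geq A (interp A f [a]) b \<longleftrightarrow> b \<le> interp A f [a]" and "a \<le> interp A f [a]"
proof -
  obtain w w0 p ws where A: "A = ms_algebra w w0 p ws"
    using assms by (auto simp: is_ms_algebra_def)
  show "geq A (interp A f [a]) b \<longleftrightarrow> b \<le> interp A f [a]"
    by (simp add: A ms_algebra_def)
  show "a \<le> interp A f [a]"
    by (cases "ws f") (simp_all add: A ms_algebra_def)
qed

lemma kbo_syn_neq_wpo:
  fixes x :: 'v
  assumes A: "is_ms_algebra F ar A" and "f \<noteq> g" "w f = 0" "w g = 0"
  shows "wpo A pr \<sigma> (Fun f [Fun g [Var x]]) (Var x)"
    and "\<not> kbo_syn pr \<sigma> w w0 (Fun f [Fun g [Var x]]) (Var x)"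
proof -
  note u = ms_algebra_unary[OF A]
  have "alg_geq A (Fun g [Var x]) (Var x)" "alg_geq A (Fun f [Fun g [Var x]]) (Var x)"
    using u by (auto simp: alg_geq_def intro: order.trans[OF u(2) u(2)])
  then show "wpo A pr \<sigma> (Fun f [Fun g [Var x]]) (Var x)"
    by (meson list.set_intros(1) wpo.sub)
  have "tower (replicate k f) (Var x) \<noteq> Fun f [Fun g [Var x]]" for k
    using \<open>f \<noteq> g\<close> by (cases k; cases "k - 1") (auto simp: tower_def)
  then show "\<not> kbo_syn pr \<sigma> w w0 (Fun f [Fun g [Var x]]) (Var x)"
    using assms(3,4) by (auto elim!: kbo_syn.cases) metis
qed

end

theory Submission
  imports Defs
begin

text \<open>
  For LPO take the algebra in which every symbol is interpreted by the maximum of its arguments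
  and 0: it satisfies \<open>s > t\<close> for no pair of terms, and \<open>s \<ge> t\<close> whenever \<open>s\<close> is greater
  than \<open>t\<close> in LPO, so the algebraic conditions of WPO disappear.

  For KBO take the algebra of sums. It compares two terms by weight, subject to the condition on
  variable occurrences. What remains is to show that the subterm conditions of WPO are harmless.
  Because \<open>w0 > 0\<close>, an argument has the weight of the whole term only if the root
  symbol is unary of weight 0, and then admissibility makes that symbol maximal.
\<close>

section \<open>Terms over the signature, permuted arguments and lexicographic comparison\<close>

lemma Fun_in_terms_iff:
  "Fun f ss \<in> terms F ar \<longleftrightarrow> f \<in> F \<and> length ss = ar f \<and> set ss \<subseteq> terms F ar"
  by (auto elim: terms.cases intro: terms.app)

lemma set_permute:
  assumes "is_status F ar \<sigma>" "f \<in> F" "length ss = ar f"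
  shows "set (permute (\<sigma> f) ss) = set ss"
  using assms by (auto simp: permute_def is_status_def set_conv_nth[of ss])

lemma length_permute:
  assumes "is_status F ar \<sigma>" "f \<in> F"
  shows "length (permute (\<sigma> f) ss) = ar f"
  using assms distinct_card[of "\<sigma> f"] by (simp add: permute_def is_status_def)

text \<open>Both entries may be assumed to lie in the compared lists, because the induction
  hypotheses relating WPO and KBO speak only of terms over the signature.\<close>

lemma lex_ext_mono_on:
  assumes "lex_ext r ss ts"
    and "\<And>s t. s \<in> set ss \<Longrightarrow> t \<in> set ts \<Longrightarrow> r s t \<Longrightarrow> r' s t"
  shows "lex_ext r' ss ts"
proof -
  obtain k where k: "k < length ss" "k \<le> length ts"
      "\<forall>i < k. ss ! i = ts ! i \<or> r (ss ! i) (ts ! i)"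
      "k = length ts \<or> (k < length ts \<and> r (ss ! k) (ts ! k))"
    using assms(1) unfolding lex_ext_def by blast
  have r': "r' (ss ! i) (ts ! i)" if "r (ss ! i) (ts ! i)" "i \<le> k" "i < length ts" for i
    using assms(2) that k(1) by (meson le_less_trans nth_mem)
  have "\<forall>i < k. ss ! i = ts ! i \<or> r' (ss ! i) (ts ! i)"
      "k = length ts \<or> (k < length ts \<and> r' (ss ! k) (ts ! k))"
    using k(2-4) r' by force+
  with k(1,2) show ?thesis unfolding lex_ext_def by blast
qed

lemma lex_ext_singleton_right:
  "lex_ext r ss [t] \<Longrightarrow> \<exists>s \<in> set ss. s = t \<or> r s t"
  by (cases ss) (auto simp: lex_ext_def less_Suc_eq_le le_Suc_eq)

text \<open>Position 0 decides, so \<open>ts\<close> may have any length; equivalent symbols need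
  not have equal arity.\<close>

lemma lex_ext_singleton_left:
  assumes "ts \<noteq> [] \<Longrightarrow> r s (hd ts)"
  shows "lex_ext r [s] ts"
  using assms by (cases ts) (auto simp: lex_ext_def)

lemma permute_terms_subset:
  assumes "is_status F ar \<sigma>" "Fun f ss \<in> terms F ar"
  shows "set (permute (\<sigma> f) ss) \<subseteq> terms F ar"
  using assms by (auto simp: set_permute Fun_in_terms_iff)


section \<open>The maximum algebra and LPO\<close>

abbreviation max_algebra :: "('f, nat) ordered_algebra" where
  "max_algebra \<equiv> ms_algebra (\<lambda>_. 0) 0 (\<lambda>_ _. 0) (\<lambda>_. Max)"

text \<open>Describes the maximum by its upper bounds, which hides \<open>Max\<close>; the constant
  0 in it is below every natural number.\<close>

lemma eval_max_le_iff:
  "eval max_algebra \<alpha> (Fun f ss) \<le> (b :: nat) \<longleftrightarrow> (\<forall>s \<in> set ss. eval max_algebra \<alpha> s \<le> b)"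
proof -
  have "{0 + map (eval max_algebra \<alpha>) ss ! i | i. i < length (map (eval max_algebra \<alpha>) ss)}
      = eval max_algebra \<alpha> ` set ss"
    unfolding set_map[symmetric] by (auto simp: set_conv_nth simp del: set_map)
  then show ?thesis
    by (simp add: ms_algebra_def)
qed

lemma eval_max_zero: "eval max_algebra (\<lambda>_. 0) t = 0"
proof (induction t)
  case (Fun f ss)
  then show ?case using eval_max_le_iff[of _ f ss 0] by simp
qed simp

text \<open>Under the assignment constantly 0 all terms have value 0.\<close>

lemma not_alg_gt_max: "\<not> alg_gt max_algebra s t"
  using eval_max_zero[of s] eval_max_zero[of t]
  by (auto simp: alg_gt_def ms_algebra_def intro!: exI[of _ "\<lambda>_. 0"])

lemma alg_geq_max_iff:
  "alg_geq max_algebra s t \<longleftrightarrow> (\<forall>\<alpha>. eval max_algebra \<alpha> t \<le> eval max_algebra \<alpha> s)"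
  by (simp add: alg_geq_def ms_algebra_def)

text \<open>An argument is below the maximum that contains it. For the other two rules, the left
  side bounds every argument on the right and hence their maximum.\<close>

lemma lpo_imp_alg_geq:
  assumes "lpo pr \<sigma> s t"
  shows "alg_geq max_algebra s t"
  using assms unfolding alg_geq_max_iff
proof (induction rule: lpo.induct)
  case (sub s ss t f)
  then show ?case
    using eval_max_le_iff[of _ f ss] by (meson order.trans order_refl)
qed (simp_all only: eval_max_le_iff, blast+)

lemma lpo_imp_wpo:
  assumes "lpo pr \<sigma> s t"
  shows "wpo max_algebra pr \<sigma> s t"
  using assms
proof (induction rule: lpo.induct)
  case (sub s ss t f)
  then have "lpo pr \<sigma> (Fun f ss) t" by (blast intro: lpo.sub)
  with sub show ?case by (blast intro: wpo.sub lpo_imp_alg_geq)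
next
  case (prec ts f ss g)
  then have "lpo pr \<sigma> (Fun f ss) (Fun g ts)" by (blast intro: lpo.prec)
  with prec show ?case by (blast intro: wpo.prec lpo_imp_alg_geq)
next
  case (lex ts f ss g)
  \<comment> \<open>The induction hypothesis compares entries by the conjunction of the two orders;
    each of them is projected out.\<close>
  have l: "lex_ext (lpo pr \<sigma>) (permute (\<sigma> f) ss) (permute (\<sigma> g) ts)"
    and l': "lex_ext (wpo max_algebra pr \<sigma>) (permute (\<sigma> f) ss) (permute (\<sigma> g) ts)"
    by (rule lex_ext_mono_on[OF lex.IH(2)]; blast)+
  then have "lpo pr \<sigma> (Fun f ss) (Fun g ts)" using lex by (blast intro: lpo.lex)
  with lex l' show ?case by (blast intro: wpo.lex lpo_imp_alg_geq)
qed

lemma wpo_imp_lpo: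
  assumes "wpo max_algebra pr \<sigma> s t"
  shows "lpo pr \<sigma> s t"
  using assms
proof (induction rule: wpo.induct)
  case (lex f ss g ts)
  have "lex_ext (lpo pr \<sigma>) (permute (\<sigma> f) ss) (permute (\<sigma> g) ts)"
    by (rule lex_ext_mono_on[OF lex.IH(2)]) blast
  with lex show ?case by (blast intro: lpo.lex)
qed (use not_alg_gt_max in \<open>blast intro: lpo.intros\<close>)+

lemma lpo_eq_wpo_max: "lpo pr \<sigma> s t \<longleftrightarrow> wpo max_algebra pr \<sigma> s t"
  by (blast intro: lpo_imp_wpo wpo_imp_lpo)


section \<open>The sum algebra\<close>

abbreviation sum_algebra :: "('f \<Rightarrow> nat) \<Rightarrow> nat \<Rightarrow> ('f, nat) ordered_algebra" where
  "sum_algebra w w0 \<equiv> ms_algebra w w0 (\<lambda>_ _. 0) (\<lambda>_. Pol)"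

lemma eval_sum_Fun:
  "eval (sum_algebra w w0) \<alpha> (Fun f ss) = w f + (\<Sum>s\<leftarrow>ss. eval (sum_algebra w w0) \<alpha> s)"
  by (simp add: ms_algebra_def)

lemma finite_set2_trm: "finite (set2_trm t)"
  by (induction t) auto

text \<open>Each occurrence of \<open>x\<close> contributes \<open>w0\<close>, which the weight
  counts, plus the excess \<open>\<alpha> x - w0\<close>. Any finite \<open>X\<close> covering the
  variables is allowed, so that two terms can share it.\<close>

lemma eval_sum:
  assumes "\<forall>x. w0 \<le> \<alpha> x" "finite X" "set2_trm t \<subseteq> X"
  shows "eval (sum_algebra w w0) \<alpha> t = weight w w0 t + (\<Sum>x\<in>X. occ x t * (\<alpha> x - w0))"
  using assms(3)
proof (induction t)
  case (Var y)
  have "(\<Sum>x\<in>X. occ x (Var y) * (\<alpha> x - w0)) = (\<Sum>x\<in>X. if x = y then \<alpha> x - w0 else 0)"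
    by (rule sum.cong) auto
  also have "\<dots> = \<alpha> y - w0"
    using Var assms(2) by simp
  finally show ?case
    using assms(1) by simp
next
  case (Fun f ss)
  have "(\<Sum>s\<leftarrow>ss. eval (sum_algebra w w0) \<alpha> s)
      = (\<Sum>s\<leftarrow>ss. weight w w0 s) + (\<Sum>x\<in>X. (\<Sum>s\<leftarrow>ss. occ x s) * (\<alpha> x - w0))"
    using Fun
    by (induction ss) (auto simp: sum.distrib distrib_right)
  then show ?case
    by (simp add: eval_sum_Fun del: eval.simps(2))
qed

text \<open>The assignments constantly \<open>w0\<close>, except for a large value at a single variable, recover
  the weight and the number of occurrences of each variable from the interpretation.\<close>

lemma eval_sum_point:
  "eval (sum_algebra w w0) ((\<lambda>_. w0)(x := w0 + K)) t = weight w w0 t + occ x t * K"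
proof -
  let ?X = "insert x (set2_trm t)"
  have "(\<Sum>y\<in>?X. occ y t * (((\<lambda>_. w0)(x := w0 + K)) y - w0))
      = (\<Sum>y\<in>?X. if y = x then occ x t * K else 0)"
    by (rule sum.cong) auto
  also have "\<dots> = occ x t * K"
    using finite_set2_trm[of t] by (simp only: sum.delta finite_insert) simp
  finally show ?thesis
    using eval_sum[of w0 "(\<lambda>_. w0)(x := w0 + K)" ?X t w] finite_set2_trm[of t] by fastforce
qed

lemma alg_geq_sum_iff:
  "alg_geq (sum_algebra w w0) s t \<longleftrightarrow>
     (\<forall>x. occ x t \<le> occ x s) \<and> weight w w0 t \<le> weight w w0 s" (is "?L \<longleftrightarrow> ?R")
  and alg_gt_sum_iff:
  "alg_gt (sum_algebra w w0) s t \<longleftrightarrow>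
     (\<forall>x. occ x t \<le> occ x s) \<and> weight w w0 t < weight w w0 s" (is "?L' \<longleftrightarrow> ?R'")
proof -
  let ?e = "eval (sum_algebra w w0)"
  have geq: "?L \<longleftrightarrow> (\<forall>\<alpha>. (\<forall>x. w0 \<le> \<alpha> x) \<longrightarrow> ?e \<alpha> t \<le> ?e \<alpha> s)"
    by (simp add: alg_geq_def ms_algebra_def)
  have gt: "?L' \<longleftrightarrow> (\<forall>\<alpha>. (\<forall>x. w0 \<le> \<alpha> x) \<longrightarrow> ?e \<alpha> t < ?e \<alpha> s)"
    by (simp add: alg_gt_def ms_algebra_def)
  have point: "weight w w0 t + occ x t * K \<le> weight w w0 s + occ x s * K" if ?L for x K
    using that[unfolded geq, rule_format, of "(\<lambda>_. w0)(x := w0 + K)"]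
    unfolding eval_sum_point by simp
  have occ: "occ x t \<le> occ x s" if ?L for x
  proof (rule ccontr)
    assume "\<not> occ x t \<le> occ x s"
    \<comment> \<open>One missing occurrence of \<open>x\<close> costs
      \<open>Suc (weight w w0 s)\<close>, more than the weight of \<open>s\<close> can make
      up.\<close>
    then have "Suc (occ x s) * Suc (weight w w0 s) \<le> occ x t * Suc (weight w w0 s)"
      by (intro mult_right_mono) auto
    with point[OF that, of x "Suc (weight w w0 s)"] show False by simp
  qed
  \<comment> \<open>The variable parts are compared over the common variable set; adding the weak or
    strict inequality of weights then gives both converses.\<close>
  have sums: "\<exists>a b. ?e \<alpha> t = weight w w0 t + a \<and> ?e \<alpha> s = weight w w0 s + b \<and> a \<le> b"
    if "\<forall>x. occ x t \<le> occ x s" "\<forall>x. w0 \<le> \<alpha> x" for \<alpha>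
  proof (intro exI conjI)
    let ?X = "set2_trm s \<union> set2_trm t"
    show "?e \<alpha> t = weight w w0 t + (\<Sum>x\<in>?X. occ x t * (\<alpha> x - w0))"
      "?e \<alpha> s = weight w w0 s + (\<Sum>x\<in>?X. occ x s * (\<alpha> x - w0))"
      using that(2) by (auto intro: eval_sum simp: finite_set2_trm)
    show "(\<Sum>x\<in>?X. occ x t * (\<alpha> x - w0)) \<le> (\<Sum>x\<in>?X. occ x s * (\<alpha> x - w0))"
      using that(1) by (intro sum_mono mult_right_mono) auto
  qed
  show "?L \<longleftrightarrow> ?R"
  proof
    assume ?L
    with occ point[of _ 0] show ?R by simp
  next
    assume ?R
    then show ?L unfolding geq using sums by (metis add_mono)
  qed
  show "?L' \<longleftrightarrow> ?R'"
  proof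
    assume ?L'
    then have ?L unfolding geq gt by (simp add: less_imp_le)
    \<comment> \<open>With \<open>K = 0\<close> the assignment is constantly \<open>w0\<close>,
      whichever variable is picked, and the values are the weights.\<close>
    moreover have "weight w w0 t < weight w w0 s"
      using \<open>?L'\<close>[unfolded gt, rule_format, of "(\<lambda>_. w0)(undefined := w0 + 0)"]
      unfolding eval_sum_point by simp
    ultimately show ?R' using occ by blast
  next
    assume ?R'
    then show ?L' unfolding gt using sums by (metis add_less_le_mono)
  qed
qed


section \<open>KBO\<close>

locale kbo_setting =
  fixes F :: "'f set" and ar :: "'f \<Rightarrow> nat"
    and pr :: "'f \<Rightarrow> 'f \<Rightarrow> bool" and \<sigma> :: "'f \<Rightarrow> nat list"
    and w :: "'f \<Rightarrow> nat" and w0 :: nat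
  assumes prec: "quasi_precedence F pr"
    and status: "is_status F ar \<sigma>"
    and weights: "weight_function F ar w w0"
    and w0_pos: "w0 > 0"
    and adm: "admissible F ar pr w"
begin

abbreviation "KBO \<equiv> kbo pr \<sigma> w w0"
abbreviation "WPO \<equiv> wpo (sum_algebra w w0) pr \<sigma>"
abbreviation "wt \<equiv> weight w w0"

lemma weight_ge_w0: "t \<in> terms F ar \<Longrightarrow> w0 \<le> wt t"
proof (induction rule: terms.induct)
  case (app f ss)
  show ?case
  proof (cases ss)
    case Nil
    with app weights show ?thesis by (simp add: weight_function_def)
  next
    case (Cons s ss')
    with app show ?thesis by (simp add: trans_le_add1 trans_le_add2)
  qed
qed simp

text \<open>Every term weighs at least \<open>w0 > 0\<close>, so a second argument or a positive
  \<open>w f\<close> makes the whole term strictly heavier than \<open>s\<close>.\<close>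

lemma weight_arg_cases:
  assumes "Fun f ss \<in> terms F ar" "s \<in> set ss"
  obtains (less) "wt s < wt (Fun f ss)"
    | (unary) "ss = [s]" "w f = 0" "ar f = 1" "wt (Fun f ss) = wt s"
proof -
  obtain xs ys where ss: "ss = xs @ s # ys"
    using assms(2) by (auto simp: in_set_conv_decomp)
  have pos: "0 < (\<Sum>u\<leftarrow>us. wt u)" if "us \<noteq> []" "set us \<subseteq> terms F ar" for us
    using that weight_ge_w0[of "hd us"] w0_pos by (cases us) auto
  have ts: "set xs \<subseteq> terms F ar" "set ys \<subseteq> terms F ar" "ar f = length ss"
    using assms(1) ss by (auto simp: Fun_in_terms_iff)
  show ?thesis
  proof (cases "xs = [] \<and> ys = [] \<and> w f = 0")
    case True
    with ss ts show ?thesis by (intro unary) auto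
  next
    case False
    with pos[OF _ ts(1)] pos[OF _ ts(2)] have "wt s < wt (Fun f ss)"
      by (auto simp: ss)
    then show ?thesis by (rule less)
  qed
qed

lemma occ_arg: "s \<in> set ss \<Longrightarrow> occ x s \<le> occ x (Fun f ss)"
  by (simp add: member_le_sum_list)

lemma maximal_unary:
  assumes "f \<in> F" "ar f = 1" "w f = 0" "g \<in> F"
  shows "\<not> prec_gt pr g f" "prec_gt pr f g \<or> prec_eq pr f g"
  using adm assms by (auto simp: admissible_def prec_gt_def prec_eq_def)

lemma prec_eq_trans:
  assumes "prec_eq pr f g" "prec_eq pr g h" "f \<in> F" "g \<in> F" "h \<in> F"
  shows "prec_eq pr f h"
  using prec assms unfolding quasi_precedence_def prec_eq_def by (meson transp_onD)

lemma permute_singleton: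
  "f \<in> F \<Longrightarrow> ar f = 1 \<Longrightarrow> permute (\<sigma> f) [s] = [s]"
  using length_permute[OF status, of f "[s]"] set_permute[OF status, of f "[s]"]
  by (auto simp: length_Suc_conv)

lemma kbo_occ_weight:
  assumes "KBO s t"
  shows "occ x t \<le> occ x s" "wt t \<le> wt s" "\<exists>f ss. s = Fun f ss"
proof -
  show "occ x t \<le> occ x s" "wt t \<le> wt s"
    using assms by (auto elim: kbo.cases)
  show "\<exists>f ss. s = Fun f ss"
    using assms by (rule kbo.cases) blast+
qed

text \<open>Stands in for the subterm rule of WPO where the weights do not decide. If
  \<open>t\<close> is compound and of the weight of \<open>u\<close>, the maximal symbol
  \<open>f\<close> is above the root of \<open>t\<close> or equivalent to it. In the latter case
  \<open>u\<close> has to beat the first permuted argument of \<open>t\<close>, whence the induction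
  on \<open>t\<close>.\<close>

lemma kbo_unary:
  fixes t u :: "('f, 'v) trm"
  assumes "t \<in> terms F ar" "u \<in> terms F ar" "f \<in> F" "ar f = 1" "w f = 0"
    and "u = t \<or> KBO u t"
  shows "KBO (Fun f [u]) t"
  using assms
proof (induction t arbitrary: u f rule: trm.induct)
  case (Var x)
  have occ: "\<forall>y. occ y (Var x :: ('f, 'v) trm) \<le> occ y (Fun f [u])"
    using kbo_occ_weight(1)[of u "Var x"] Var.prems(6) by (auto simp del: occ.simps(1))
  from Var.prems(6) consider "u = Var x" | "KBO u (Var x)" by blast
  then show ?case
  proof cases
    case 1
    then show ?thesis
      using Var.prems by (intro kbo.var[where hs = "[]"]) (auto simp: tower_def)
  next
    case 2
    then show ?thesis
    proof cases
      case (weight h us)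
      then show ?thesis using occ by (intro kbo.weight) auto
    next
      case (var y h us hs)
      have hs: "k \<in> F \<and> ar k = 1" if "k \<in> set (h # hs)" for k
        using tower_terms[of "h # hs" "Var x" F ar] Var.prems(2) var that by metis
      \<comment> \<open>Here towers modulo equivalence matter: the root \<open>h\<close> of
        \<open>u\<close> is unary of weight 0 too, so admissibility makes it equivalent to
        \<open>f\<close>, and \<open>f\<close> extends the tower.\<close>
      have "sum_list (map w (h # hs)) = 0"
        using var weight_tower[of w w0 "h # hs" "Var x"] by simp
      then have "w h = 0" by simp
      with maximal_unary[of f h] maximal_unary(1)[of h f] hs[of h] Var.prems
      have "prec_eq pr h f" by (auto simp: prec_eq_def)
      then have "\<forall>k \<in> set (h # hs). prec_eq pr k f"
        using var hs Var.prems(3) prec_eq_trans by (metis list.set_intros(1) set_ConsD)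
      then show ?thesis
        using var occ Var.prems
        by (intro kbo.var[where hs = "h # hs"]) (auto simp: tower_def)
    qed
  qed
next
  case (Fun g ts)
  let ?t = "Fun g ts"
  have occ: "\<forall>y. occ y ?t \<le> occ y (Fun f [u])"
    using kbo_occ_weight(1)[of u ?t] Fun.prems(6) by auto
  have le: "wt ?t \<le> wt u"
    using kbo_occ_weight(2)[of u ?t] Fun.prems(6) by auto
  have g: "g \<in> F" "length ts = ar g" "set ts \<subseteq> terms F ar"
    using Fun.prems(1) by (auto simp: Fun_in_terms_iff)
  consider (less) "wt ?t < wt u" | (gt) "wt u = wt ?t" "prec_gt pr f g"
    | (eq) "wt u = wt ?t" "prec_eq pr f g"
    using le maximal_unary(2)[of f g] Fun.prems g(1) by linarith
  then show ?case
  proof cases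
    case less
    then show ?thesis using occ by (intro kbo.weight) auto
  next
    case gt
    then show ?thesis using occ Fun.prems(5) by (intro kbo.prec) auto
  next
    case eq
    \<comment> \<open>The status may put any argument of \<open>?t\<close> first, so all of them are
      treated.\<close>
    have "KBO u t'" if t': "t' \<in> set ts" for t'
    proof -
      have occ': "\<forall>y. occ y t' \<le> occ y u"
        using occ occ_arg[OF t', of _ g] by (auto intro: order.trans)
      obtain h us where u: "u = Fun h us"
        using Fun.prems(6) kbo_occ_weight(3) by blast
      have h: "h \<in> F" "set us \<subseteq> terms F ar" "length us = ar h"
        using Fun.prems(2) u by (auto simp: Fun_in_terms_iff)
      from Fun.prems(1) t' show ?thesis
      proof (cases rule: weight_arg_cases)
        case less
        then show ?thesis using eq occ' u by (auto intro: kbo.weight)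
      next
        case unary
        \<comment> \<open>Like \<open>f\<close>, the root \<open>h\<close> of \<open>u\<close> is
          unary of weight 0, so the induction hypothesis for \<open>t'\<close> applies with
          \<open>h\<close> and \<open>u'\<close>.\<close>
        have "\<exists>u' \<in> set us. w h = 0 \<and> ar h = 1 \<and> us = [u'] \<and> (u' = t' \<or> KBO u' t')"
        proof (cases "u = ?t")
          case True
          with unary u show ?thesis by auto
        next
          case False
          then have "KBO u ?t" using Fun.prems(6) by blast
          \<comment> \<open>The weights are equal and \<open>g\<close> is maximal, which leaves only
            the lexicographic rule.\<close>
          then have "lex_ext KBO (permute (\<sigma> h) us) (permute (\<sigma> g) ts)"
            using eq(1) maximal_unary(1)[OF g(1) unary(3,2) h(1)] u by (auto elim: kbo.cases)
          then obtain u' where u': "u' \<in> set us" "u' = t' \<or> KBO u' t'"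
            using lex_ext_singleton_right set_permute[OF status h(1,3)]
              permute_singleton[OF g(1) unary(3)] unary(1) by metis
          have "wt t' \<le> wt u'" using u'(2) kbo_occ_weight(2) by auto
          \<comment> \<open>Since \<open>u\<close>, \<open>?t\<close> and \<open>t'\<close> weigh
            the same, \<open>u'\<close> is no lighter than \<open>u\<close>.\<close>
          then have "\<not> wt u' < wt (Fun h us)" using eq(1) unary(4) u by simp
          with u' Fun.prems(2) show ?thesis
            unfolding u by (metis weight_arg_cases)
        qed
        with Fun.IH[OF t', of _ h] g(3) h t' u show ?thesis by auto
      qed
    qed
    then have "permute (\<sigma> g) ts \<noteq> [] \<Longrightarrow> KBO u (hd (permute (\<sigma> g) ts))"
      using set_permute[OF status g(1,2)] by (metis list.set_sel(1))
    then have "lex_ext KBO (permute (\<sigma> f) [u]) (permute (\<sigma> g) ts)"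
      using permute_singleton[OF Fun.prems(3,4)] lex_ext_singleton_left by metis
    then show ?thesis using occ eq Fun.prems(5) by (intro kbo.lex) auto
  qed
qed

section \<open>The two inclusions between KBO and WPO over the sum algebra\<close>

lemma wpo_imp_kbo:
  assumes "WPO s t" "s \<in> terms F ar" "t \<in> terms F ar"
  shows "KBO s t"
  using assms
proof (induction rule: wpo.induct)
  case (gt f ss t)
  then show ?case by (auto simp: alg_gt_sum_iff intro: kbo.weight)
next
  \<comment> \<open>This is the only rule of WPO without a counterpart in KBO: either the argument
    \<open>s\<close> is strictly lighter than the whole term, or \<open>kbo_unary\<close>
    applies.\<close>
  case (sub f ss t s)
  have s: "s \<in> terms F ar" using sub by (auto simp: Fun_in_terms_iff)
  with sub have st: "s = t \<or> KBO s t" by blast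
  then have le: "wt t \<le> wt s" using kbo_occ_weight(2) by auto
  from sub.prems(1) sub.hyps(2) show ?case
  proof (cases rule: weight_arg_cases)
    case less
    then show ?thesis using le sub.hyps(1) by (auto simp: alg_geq_sum_iff intro: kbo.weight)
  next
    case unary
    then show ?thesis
      using kbo_unary[OF sub.prems(2) s _ _ _ st] sub.prems(1) by (simp add: Fun_in_terms_iff)
  qed
next
  case (prec f ss g ts)
  then show ?case
    by (cases "wt (Fun g ts) < wt (Fun f ss)") (auto simp: alg_geq_sum_iff intro: kbo.weight kbo.prec)
next
  case (lex f ss g ts)
  have "lex_ext KBO (permute (\<sigma> f) ss) (permute (\<sigma> g) ts)"
    by (rule lex_ext_mono_on[OF lex.IH(2)])
      (use permute_terms_subset[OF status] lex.prems in blast)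
  with lex.hyps show ?case
    by (cases "wt (Fun g ts) < wt (Fun f ss)") (auto simp: alg_geq_sum_iff intro: kbo.weight kbo.lex)
qed

text \<open>The subterm rule peels off one symbol at a time; a tower keeps the occurrences in
  \<open>t\<close> and weighs at least as much.\<close>

lemma wpo_tower: "WPO (tower (f # hs) t) t"
proof (induction hs arbitrary: f)
  case Nil
  show ?case
    by (auto simp: tower_def alg_geq_sum_iff intro!: wpo.sub)
next
  case (Cons h hs)
  have "occ x t \<le> occ x (tower ks t)" for x and ks :: "'f list"
    by (induction ks) (auto simp: tower_def)
  then have "alg_geq (sum_algebra w w0) (tower (f # h # hs) t) t"
    by (simp add: alg_geq_sum_iff weight_tower)
  with Cons[of h] show ?case
    by (auto simp: tower_def intro: wpo.sub)
qed

text \<open>WPO also demands that the left side beats each argument \<open>t\<close> on the right. A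
  lighter \<open>t\<close> is beaten by weight; otherwise the right root is unary of weight 0, hence
  maximal, so nothing lies strictly above it in the precedence.\<close>

lemma kbo_imp_wpo:
  assumes "KBO s t" "s \<in> terms F ar" "t \<in> terms F ar"
  shows "WPO s t"
  using assms
proof (induction rule: kbo.induct)
  case (weight t f ss)
  then show ?case by (intro wpo.gt) (simp add: alg_gt_sum_iff)
next
  case (var t x f ss hs)
  then show ?case using wpo_tower by metis
next
  case (prec g ts f ss)
  have fg: "f \<in> F" "g \<in> F" using prec.prems by (auto simp: Fun_in_terms_iff)
  have occ: "\<forall>x. occ x t \<le> occ x (Fun f ss)" if "t \<in> set ts" for t
    using occ_arg[OF that, of _ g] prec.hyps(1) order.trans by blast
  have "WPO (Fun f ss) t" if t: "t \<in> set ts" for t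
    using prec.prems(2) t
  proof (cases rule: weight_arg_cases)
    case less
    then show ?thesis
      using prec.hyps(2) occ[OF t] by (intro wpo.gt) (simp add: alg_gt_sum_iff del: occ.simps)
  next
    case unary
    then show ?thesis using maximal_unary(1)[of g f] fg prec.hyps(3) by blast
  qed
  with prec.hyps show ?case by (intro wpo.prec) (auto simp: alg_geq_sum_iff)
next
  case (lex g ts f ss)
  have fg: "f \<in> F" "g \<in> F" "length ss = ar f" using lex.prems by (auto simp: Fun_in_terms_iff)
  have l: "lex_ext WPO (permute (\<sigma> f) ss) (permute (\<sigma> g) ts)"
    by (rule lex_ext_mono_on[OF lex.IH])
      (use permute_terms_subset[OF status] lex.prems in blast)
  have occ: "\<forall>x. occ x t \<le> occ x (Fun f ss)" if "t \<in> set ts" for t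
    using occ_arg[OF that, of _ g] lex.hyps(1) order.trans by blast
  have "WPO (Fun f ss) t" if t: "t \<in> set ts" for t
    using lex.prems(2) t
  proof (cases rule: weight_arg_cases)
    case less
    then show ?thesis
      using lex.hyps(2) occ[OF t] by (intro wpo.gt) (simp add: alg_gt_sum_iff del: occ.simps)
  next
    case unary
    \<comment> \<open>The right side has the single argument \<open>t\<close>, so the lexicographic
      comparison yields an argument on the left that is at least \<open>t\<close>, and the subterm
      rule applies.\<close>
    then obtain s where "s \<in> set ss" "s = t \<or> WPO s t"
      using lex_ext_singleton_right l set_permute[OF status fg(1,3)]
        permute_singleton[OF fg(2)] by metis
    moreover have "alg_geq (sum_algebra w w0) (Fun f ss) t"
      using lex.hyps(2) occ[OF t] unary(4) by (simp add: alg_geq_sum_iff del: occ.simps)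
    ultimately show ?thesis by (blast intro: wpo.sub)
  qed
  with lex.hyps l show ?case by (intro wpo.lex) (auto simp: alg_geq_sum_iff)
qed

end

theorem theorem20:
  fixes F :: "'f set" and ar :: "'f \<Rightarrow> nat"
    and pr :: "'f \<Rightarrow> 'f \<Rightarrow> bool" and \<sigma> :: "'f \<Rightarrow> nat list"
  assumes "finite F" and "quasi_precedence F pr" and "is_status F ar \<sigma>"
  shows "(\<exists>A. is_ms_algebra F ar A \<and>
            (\<forall>s \<in> (terms F ar :: ('f, 'v) trm set). \<forall>t \<in> terms F ar.
               lpo pr \<sigma> s t \<longleftrightarrow> wpo A pr \<sigma> s t)) \<and>
         (\<forall>w w0. weight_function F ar w w0 \<and> w0 > 0 \<and> admissible F ar pr w \<longrightarrow>
            (\<exists>A. is_ms_algebra F ar A \<and>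
               (\<forall>s \<in> (terms F ar :: ('f, 'v) trm set). \<forall>t \<in> terms F ar.
                  kbo pr \<sigma> w w0 s t \<longleftrightarrow> wpo A pr \<sigma> s t)))"
proof (intro conjI allI impI)
  have "is_ms_algebra F ar max_algebra"
    unfolding is_ms_algebra_def weight_function_def by blast
  then show "\<exists>A. is_ms_algebra F ar A \<and>
      (\<forall>s \<in> (terms F ar :: ('f, 'v) trm set). \<forall>t \<in> terms F ar.
         lpo pr \<sigma> s t \<longleftrightarrow> wpo A pr \<sigma> s t)"
    using lpo_eq_wpo_max by blast
next
  fix w w0
  assume w: "weight_function F ar w w0 \<and> w0 > 0 \<and> admissible F ar pr w"
  with assms interpret kbo_setting F ar pr \<sigma> w w0
    by unfold_locales auto
  have "is_ms_algebra F ar (sum_algebra w w0)"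
    using w unfolding is_ms_algebra_def by blast
  then show "\<exists>A. is_ms_algebra F ar A \<and>
      (\<forall>s \<in> (terms F ar :: ('f, 'v) trm set). \<forall>t \<in> terms F ar.
         kbo pr \<sigma> w w0 s t \<longleftrightarrow> wpo A pr \<sigma> s t)"
    using kbo_imp_wpo wpo_imp_kbo by blast
qed

end
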